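(* For every odd prime $p$, there is a soluble group $G_p$ of order $2^6p^8$ which has no increasing unrefinable subgroup chain.
   Context: Let $G$ be a nontrivial finite group. An unrefinable chain of subgroups of $G$ is a chain $1=G_0<G_1<\cdots<G_n=G$ of subgroups in which $G_{i-1}$ is a maximal subgroup of $G_i$ for every $i=1,\dots,n$. With such a chain associate the indices $j_i=\lvert G_i:G_{i-1}\rvert$. The chain is called increasing if $j_1\le j_2\le\cdots\le j_n$ (indices nondecreasing from the bottom $1$ to the top $G$). *)

theory Defs
  imports "HOL-Algebra.Solvable_Groups" "HOL-Computational_Algebra.Primes"
begin

definition maximal_subgroup :: "'a set \<Rightarrow> ('a, 'b) monoid_scheme \<Rightarrow> bool" where
  "maximal_subgroup H G \<longleftrightarrow>
     subgroup H G \<and> H \<noteq> carrier G \<and>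
     (\<forall>K. subgroup K G \<longrightarrow> H \<subseteq> K \<longrightarrow> K = H \<or> K = carrier G)"

definition subgroup_index :: "('a, 'b) monoid_scheme \<Rightarrow> 'a set \<Rightarrow> nat" where
  "subgroup_index G H = card (rcosets\<^bsub>G\<^esub> H)"

text \<open>
  A chain of length \<open>n\<close> is a function \<open>C\<close> on the naturals, of which only the values
  \<open>C 0, \<dots>, C n\<close> matter. The subgroup \<open>C i\<close> is regarded as a group in its own right
  via \<open>G\<lparr>carrier := C i\<rparr>\<close>.
\<close>

definition unrefinable_chain ::
  "('a, 'b) monoid_scheme \<Rightarrow> nat \<Rightarrow> (nat \<Rightarrow> 'a set) \<Rightarrow> bool" where
  "unrefinable_chain G n C \<longleftrightarrow>
     C 0 = {\<one>\<^bsub>G\<^esub>} \<and> C n = carrier G \<and>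
     (\<forall>i\<in>{0..n}. subgroup (C i) G) \<and>
     (\<forall>i\<in>{1..n}. maximal_subgroup (C (i - 1)) (G\<lparr>carrier := C i\<rparr>))"

definition chain_index ::
  "('a, 'b) monoid_scheme \<Rightarrow> (nat \<Rightarrow> 'a set) \<Rightarrow> nat \<Rightarrow> nat" where
  "chain_index G C i = subgroup_index (G\<lparr>carrier := C i\<rparr>) (C (i - 1))"

definition increasing_chain ::
  "('a, 'b) monoid_scheme \<Rightarrow> nat \<Rightarrow> (nat \<Rightarrow> 'a set) \<Rightarrow> bool" where
  "increasing_chain G n C \<longleftrightarrow>
     (\<forall>i\<in>{1..<n}. chain_index G C i \<le> chain_index G C (i + 1))"

end

theory Submission
  imports Defs "HOL-Algebra.Weak_Morphisms"
begin

text \<open>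
  Let \<open>D\<close> be the dihedral group of order 8, acting on \<open>V = F_p^2\<close> by signed permutations, and let
  \<open>P\<close> be the group of all triples \<open>(a, b, c)\<close> in \<open>V \<times> V \<times> (V \<otimes> V)\<close> with product
  \<open>(a + a', b + b', c + c' + a \<otimes> b')\<close>. The group is \<open>G = P \<rtimes> (D \<times> D)\<close>. Its subgroup
  \<open>Z = V \<otimes> V\<close> is a minimal normal subgroup of order \<open>p\<^sup>4\<close> which is central in \<open>P\<close>.

  In an unrefinable chain, a step \<open>H < K\<close> with \<open>K \<inter> P \<subseteq> H\<close> is a step in the 2-group \<open>G / P\<close> and has
  index 2. Consider the first member \<open>K\<close> of an increasing chain that contains \<open>Z\<close> and its predecessor
  \<open>H\<close>. The index of this step is at least \<open>|Z : H \<inter> Z|\<close>, which is odd and not 1,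
  hence it is greater than 2, and so is that of every later step; therefore \<open>H P = G\<close>. Then \<open>H \<inter> Z\<close> is
  normal in \<open>G\<close>, hence trivial, and the index is at least \<open>p\<^sup>4\<close>. If \<open>K = G\<close>, then \<open>P\<close> is the product of the central subgroup \<open>Z\<close> and of
  \<open>H \<inter> P\<close>, which is abelian because its commutators lie in \<open>H \<inter> Z\<close>; but \<open>P\<close> is not abelian.
  Otherwise the last member \<open>M\<close> below \<open>G\<close> contains \<open>Z\<close>, and since it cannot contain \<open>P\<close>, its index
  is bounded by that of two consecutive terms of \<open>Z < W < P\<close>, where \<open>W = V \<times> (V \<otimes> V)\<close>,
  that is by \<open>p\<^sup>2\<close>. So the indices are not increasing.
\<close>

section \<open>A criterion for the absence of increasing chains\<close>

text \<open>All fibres of the multiplication map on \<open>H \<times> N\<close> have the size of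
  \<open>H \<inter> N\<close>: the fibre over \<open>h \<otimes> n\<close> consists of the pairs
  \<open>(h \<otimes> d, inv d \<otimes> n)\<close>.\<close>

lemma (in group) card_set_mult_Int:
  assumes H: "subgroup H G" and N: "subgroup N G" and fin: "finite (carrier G)"
  shows "card (H <#> N) * card (H \<inter> N) = card H * card N"
proof -
  interpret H: subgroup H G by (rule H)
  interpret N: subgroup N G by (rule N)
  have fH: "finite H" and fN: "finite N"
    using H.subset N.subset fin finite_subset by auto
  let ?f = "\<lambda>(h, n). h \<otimes> n"
  have fiber: "card {x \<in> H \<times> N. ?f x = y} = card (H \<inter> N)" if y: "y \<in> ?f ` (H \<times> N)" for y
  proof -
    obtain h n where hn: "h \<in> H" "n \<in> N" "y = h \<otimes> n"
      using y by auto
    have "bij_betw (\<lambda>d. (h \<otimes> d, inv d \<otimes> n)) (H \<inter> N) {x \<in> H \<times> N. ?f x = y}"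
    proof (rule bij_betw_byWitness[where f' = "\<lambda>(a, b). inv h \<otimes> a"])
      show "\<forall>d\<in>H \<inter> N. (\<lambda>(a, b). inv h \<otimes> a) (h \<otimes> d, inv d \<otimes> n) = d"
        using hn by (auto simp: m_assoc[symmetric])
      show "\<forall>x\<in>{x \<in> H \<times> N. ?f x = y}.
        (\<lambda>d. (h \<otimes> d, inv d \<otimes> n)) ((\<lambda>(a, b). inv h \<otimes> a) x) = x"
      proof
        fix x assume "x \<in> {x \<in> H \<times> N. ?f x = y}"
        then obtain a b where ab: "x = (a, b)" "a \<in> H" "b \<in> N" "a \<otimes> b = y"
          by auto
        have "inv (inv h \<otimes> a) \<otimes> n = inv a \<otimes> (h \<otimes> n)"
          using ab hn by (simp add: inv_mult_group m_assoc)
        also have "\<dots> = inv a \<otimes> (a \<otimes> b)"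
          using ab hn by simp
        also have "\<dots> = b"
          using ab(2,3) by (simp add: m_assoc[symmetric])
        finally have "inv (inv h \<otimes> a) \<otimes> n = b" .
        moreover have "h \<otimes> (inv h \<otimes> a) = a"
          using ab hn by (simp add: m_assoc[symmetric])
        ultimately show "(\<lambda>d. (h \<otimes> d, inv d \<otimes> n)) ((\<lambda>(a, b). inv h \<otimes> a) x) = x"
          by (simp add: ab(1))
      qed
      show "(\<lambda>d. (h \<otimes> d, inv d \<otimes> n)) ` (H \<inter> N) \<subseteq> {x \<in> H \<times> N. ?f x = y}"
      proof
        fix x assume "x \<in> (\<lambda>d. (h \<otimes> d, inv d \<otimes> n)) ` (H \<inter> N)"
        then obtain d where d: "d \<in> H" "d \<in> N" "x = (h \<otimes> d, inv d \<otimes> n)"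
          by auto
        have "d \<otimes> (inv d \<otimes> n) = n"
          using d hn(2) by (simp flip: m_assoc)
        hence "h \<otimes> d \<otimes> (inv d \<otimes> n) = y"
          using d hn by (simp add: m_assoc)
        thus "x \<in> {x \<in> H \<times> N. ?f x = y}"
          using d hn by simp
      qed
      show "(\<lambda>(a, b). inv h \<otimes> a) ` {x \<in> H \<times> N. ?f x = y} \<subseteq> H \<inter> N"
      proof
        fix x assume "x \<in> (\<lambda>(a, b). inv h \<otimes> a) ` {x \<in> H \<times> N. ?f x = y}"
        then obtain a b where ab: "x = inv h \<otimes> a" "a \<in> H" "b \<in> N" "a \<otimes> b = h \<otimes> n"
          using hn(3) by auto
        have "inv h \<otimes> a = inv h \<otimes> (a \<otimes> b) \<otimes> inv b"
          using ab(2,3) hn(1) by (simp add: m_assoc)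
        also have "\<dots> = inv h \<otimes> (h \<otimes> n) \<otimes> inv b"
          by (simp only: ab(4))
        also have "\<dots> = n \<otimes> inv b"
          using ab(3) hn(1,2) by (simp flip: m_assoc)
        finally have "x \<in> N"
          using ab(1,3) hn(2) by simp
        thus "x \<in> H \<inter> N"
          using ab(1,2) hn(1) by simp
      qed
    qed
    from bij_betw_same_card[OF this] show ?thesis by simp
  qed
  have "card H * card N = (\<Sum>x\<in>H \<times> N. 1)"
    by (simp add: card_cartesian_product)
  also have "\<dots> = (\<Sum>y\<in>?f ` (H \<times> N). \<Sum>x\<in>{x \<in> H \<times> N. ?f x = y}. 1)"
    using fH fN by (intro sum.image_gen) auto
  also have "\<dots> = (\<Sum>y\<in>?f ` (H \<times> N). card (H \<inter> N))"
    by (intro sum.cong) (use fiber in auto)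
  also have "?f ` (H \<times> N) = H <#> N"
    by (auto simp: set_mult_def)
  finally show ?thesis by simp
qed

text \<open>Maximality relative to one ambient group, so that later arguments need no restricted
  carriers.\<close>

definition (in group) covers :: "'a set \<Rightarrow> 'a set \<Rightarrow> bool" where
  "covers H K \<longleftrightarrow> subgroup H G \<and> subgroup K G \<and> H \<subset> K \<and>
     (\<forall>L. subgroup L G \<longrightarrow> H \<subseteq> L \<longrightarrow> L \<subseteq> K \<longrightarrow> L = H \<or> L = K)"

lemma (in group) maximal_subgroup_covers:
  assumes K: "subgroup K G" and "maximal_subgroup H (G\<lparr>carrier := K\<rparr>)"
  shows "covers H K"
proof -
  have H: "subgroup H (G\<lparr>carrier := K\<rparr>)"
    using assms(2) by (simp add: maximal_subgroup_def)
  have "H \<subseteq> K"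
    using subgroup.subset[OF H] by simp
  thus ?thesis
    using assms incl_subgroup[OF K H] subgroup_incl[OF _ K]
    unfolding covers_def maximal_subgroup_def by force
qed

lemma (in group) subgroup_index_mult:
  assumes "subgroup K G" "subgroup H G" "H \<subseteq> K" "finite (carrier G)"
  shows "subgroup_index (G\<lparr>carrier := K\<rparr>) H * card H = card K"
proof -
  have "subgroup H (G\<lparr>carrier := K\<rparr>)"
    using subgroup_incl assms by blast
  from group.lagrange[OF subgroup_imp_group[OF assms(1)] this]
  show ?thesis by (simp add: subgroup_index_def order_def)
qed

lemma (in group) subgroup_set_mult_Int:
  assumes "subgroup H G" "subgroup K G" "H \<subseteq> K" "N \<lhd> G"
  shows "subgroup (H <#> (K \<inter> N)) G" "H \<subseteq> H <#> (K \<inter> N)" "K \<inter> N \<subseteq> H <#> (K \<inter> N)"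
    "H <#> (K \<inter> N) \<subseteq> K"
proof -
  interpret H: subgroup H G by fact
  interpret K: subgroup K G by fact
  interpret N: normal N G by fact
  show sub: "H \<subseteq> H <#> (K \<inter> N)" "K \<inter> N \<subseteq> H <#> (K \<inter> N)"
  proof -
    have "h = h \<otimes> \<one>" if "h \<in> H" for h
      using that by simp
    thus "H \<subseteq> H <#> (K \<inter> N)"
      unfolding set_mult_def using K.one_closed N.one_closed by blast
    have "x = \<one> \<otimes> x" if "x \<in> N" for x
      using that by simp
    thus "K \<inter> N \<subseteq> H <#> (K \<inter> N)"
      unfolding set_mult_def using H.one_closed by blast
  qed
  show le: "H <#> (K \<inter> N) \<subseteq> K"
    using assms(3) by (auto simp: set_mult_def)
  show "subgroup (H <#> (K \<inter> N)) G"
  proof (rule subgroupI)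
    show "H <#> (K \<inter> N) \<subseteq> carrier G"
      using le K.subset by blast
    show "H <#> (K \<inter> N) \<noteq> {}"
      using sub H.one_closed by blast
  next
    fix a assume "a \<in> H <#> (K \<inter> N)"
    then obtain h x where hx: "h \<in> H" "x \<in> K" "x \<in> N" "a = h \<otimes> x"
      by (auto simp: set_mult_def)
    have "h \<otimes> inv x \<otimes> inv h \<in> K \<inter> N"
      using hx assms(3) N.inv_op_closed2[of h "inv x"] by auto
    moreover have "inv a = inv h \<otimes> (h \<otimes> inv x \<otimes> inv h)"
      using hx by (simp add: inv_mult_group m_assoc[symmetric])
    ultimately show "inv a \<in> H <#> (K \<inter> N)"
      using hx unfolding set_mult_def by blast
  next
    fix a b assume a: "a \<in> H <#> (K \<inter> N)" and b: "b \<in> H <#> (K \<inter> N)"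
    from a obtain h x where 1: "h \<in> H" "x \<in> K" "x \<in> N" "a = h \<otimes> x"
      by (auto simp: set_mult_def)
    from b obtain h' x' where 2: "h' \<in> H" "x' \<in> K" "x' \<in> N" "b = h' \<otimes> x'"
      by (auto simp: set_mult_def)
    note hx = 1 2
    have "h' \<in> K"
      using hx assms(3) by blast
    with hx have "inv h' \<otimes> x \<otimes> h' \<otimes> x' \<in> K \<inter> N"
      using N.inv_op_closed1[of h' x] by simp
    moreover have "a \<otimes> b = (h \<otimes> h') \<otimes> (inv h' \<otimes> x \<otimes> h' \<otimes> x')"
    proof -
      have "h' \<otimes> (inv h' \<otimes> (x \<otimes> (h' \<otimes> x'))) = x \<otimes> (h' \<otimes> x')"
        using hx(2,3,5,6,7) by (simp flip: m_assoc)
      thus ?thesis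
        using hx by (simp add: m_assoc)
    qed
    ultimately show "a \<otimes> b \<in> H <#> (K \<inter> N)"
      using hx unfolding set_mult_def by blast
  qed
qed

text \<open>The product is a subgroup between \<open>H\<close> and \<open>K\<close>, and it is not
  \<open>H\<close> because it contains \<open>K \<inter> N\<close>.\<close>

lemma (in group) covers_eq_set_mult_Int:
  assumes "covers H K" "N \<lhd> G" "\<not> K \<inter> N \<subseteq> H"
  shows "H <#> (K \<inter> N) = K"
proof -
  have "subgroup H G" "subgroup K G" "H \<subseteq> K"
    using assms(1) by (auto simp: covers_def)
  note sm = subgroup_set_mult_Int[OF this assms(2)]
  show ?thesis
    using assms(1,3) sm unfolding covers_def by blast
qed

text \<open>This is |K:H| <= |N:M| without division. As K = H(K Int N), the index equals |K Int N :
  H Int N|, which is at most |K Int N : K Int M| = |(K Int N)M : M|, and (K Int N)M lies in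
  N.\<close>

lemma (in group) covers_card_le:
  assumes cov: "covers H K" and fin: "finite (carrier G)"
    and M: "M \<lhd> G" and N: "N \<lhd> G" and "M \<subseteq> N"
    and "K \<inter> M \<subseteq> H" and "\<not> K \<inter> N \<subseteq> H"
  shows "card K * card M \<le> card H * card N"
proof -
  have HK: "subgroup H G" "subgroup K G" "H \<subseteq> K"
    using cov by (auto simp: covers_def)
  have sN: "subgroup N G" and sM: "subgroup M G"
    using M N normal_imp_subgroup by auto
  have sKN: "subgroup (K \<inter> N) G"
    using HK sN subgroups_Inter_pair by blast
  have fN: "finite N" and fH: "finite H"
    using sN HK fin finite_subset subgroup.subset by blast+
  have eq: "H <#> (K \<inter> N) = K"
    using covers_eq_set_mult_Int assms by blast
  have "H \<inter> (K \<inter> N) = H \<inter> N"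
    using HK by auto
  with card_set_mult_Int[OF HK(1) sKN fin] eq
  have 1: "card K * card (H \<inter> N) = card H * card (K \<inter> N)" by simp
  have "K \<inter> N \<inter> M = K \<inter> M"
    using \<open>M \<subseteq> N\<close> by auto
  with card_set_mult_Int[OF sKN sM fin]
  have 2: "card ((K \<inter> N) <#> M) * card (K \<inter> M) = card (K \<inter> N) * card M" by simp
  have "(K \<inter> N) <#> M \<subseteq> N"
    using \<open>M \<subseteq> N\<close> subgroup.m_closed[OF sN] by (auto simp: set_mult_def)
  hence "card ((K \<inter> N) <#> M) \<le> card N"
    using fN card_mono by blast
  moreover have "K \<inter> M \<subseteq> H \<inter> N"
    using assms by auto
  hence "card (K \<inter> M) \<le> card (H \<inter> N)"
    using fN card_mono by blast
  ultimately have 3: "card (K \<inter> N) * card M \<le> card N * card (H \<inter> N)"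
    unfolding 2[symmetric] by (rule mult_le_mono)
  have "card K * card M * card (H \<inter> N) = card H * (card (K \<inter> N) * card M)"
    using 1 by (simp add: mult.commute mult.left_commute)
  also have "\<dots> \<le> card H * (card N * card (H \<inter> N))"
    using 3 by simp
  finally have "card K * card M * card (H \<inter> N) \<le> card H * card N * card (H \<inter> N)"
    by (simp add: mult.assoc)
  moreover have "\<one> \<in> H \<inter> N"
    using HK sN subgroup.one_closed by blast
  hence "card (H \<inter> N) > 0"
    using fN by (auto simp: card_gt_0_iff)
  ultimately show ?thesis by simp
qed

text \<open>This is |K:H| >= |Z : H Int Z|, which holds because HZ lies in K.\<close>

lemma (in group) covers_card_ge:
  assumes cov: "covers H K" and fin: "finite (carrier G)" and Z: "subgroup Z G" "Z \<subseteq> K"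
  shows "card H * card Z \<le> card K * card (H \<inter> Z)"
proof -
  have HK: "subgroup H G" "subgroup K G" "H \<subseteq> K"
    using cov by (auto simp: covers_def)
  have "finite K"
    using HK fin finite_subset subgroup.subset by blast
  moreover have "H <#> Z \<subseteq> K"
    using HK Z subgroup.m_closed[OF HK(2)] by (auto simp: set_mult_def)
  ultimately have "card (H <#> Z) \<le> card K"
    using card_mono by blast
  hence "card (H <#> Z) * card (H \<inter> Z) \<le> card K * card (H \<inter> Z)"
    by simp
  thus ?thesis
    unfolding card_set_mult_Int[OF HK(1) Z(1) fin] .
qed

section \<open>Steps of a chain and their indices\<close>

lemma (in group) unrefinable_chain_covers:
  assumes "unrefinable_chain G n C" "j < n"
  shows "covers (C j) (C (Suc j))"
proof -
  have "Suc j \<in> {1..n}" "Suc j \<in> {0..n}"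
    using assms(2) by auto
  thus ?thesis
    using assms(1) maximal_subgroup_covers[of "C (Suc j)" "C j"]
    unfolding unrefinable_chain_def by (metis diff_Suc_1)
qed

lemma (in group) chain_index_mult:
  assumes "unrefinable_chain G n C" "j < n" "finite (carrier G)"
  shows "chain_index G C (Suc j) * card (C j) = card (C (Suc j))"
  using unrefinable_chain_covers[OF assms(1,2)] subgroup_index_mult[of "C (Suc j)" "C j"] assms(3)
  by (auto simp: chain_index_def covers_def)

lemma increasing_chain_mono:
  assumes inc: "increasing_chain G n C" and "i \<le> j" "j < n"
  shows "chain_index G C (Suc i) \<le> chain_index G C (Suc j)"
  using assms(2,3)
proof (induction j rule: dec_induct)
  case (step m)
  moreover have "Suc m \<in> {1..<n}"
    using step by simp
  ultimately show ?case
    using inc step unfolding increasing_chain_def by force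
qed simp

text \<open>Replaces the statement that steps in the 2-group \<open>G / N 0\<close> have index at
  most 2. The first layer of the normal series in which \<open>K\<close> outgrows \<open>H\<close>
  bounds the index by \<open>covers_card_le\<close>.\<close>

lemma (in group) covers_card_le_double:
  assumes cov: "covers H K" and fin: "finite (carrier G)"
    and N: "\<And>k. k \<le> m \<Longrightarrow> N k \<lhd> G"
    and mono: "\<And>k. k < m \<Longrightarrow> N k \<subseteq> N (Suc k)"
    and card: "\<And>k. k < m \<Longrightarrow> card (N (Suc k)) \<le> 2 * card (N k)"
    and top: "N m = carrier G"
    and P: "K \<inter> N 0 \<subseteq> H"
  shows "card K \<le> 2 * card H"
proof -
  have HK: "subgroup K G" "\<not> K \<subseteq> H"
    using cov by (auto simp: covers_def)
  have "\<not> K \<inter> N m \<subseteq> H"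
    using HK subgroup.subset by (auto simp: top)
  then obtain k where k: "k < m" "K \<inter> N k \<subseteq> H" "\<not> K \<inter> N (Suc k) \<subseteq> H"
    using P ex_least_nat_less[of "\<lambda>k. \<not> K \<inter> N k \<subseteq> H" m] by blast
  have "card K * card (N k) \<le> card H * card (N (Suc k))"
    using k by (intro covers_card_le cov fin N mono) auto
  also have "\<dots> \<le> 2 * card H * card (N k)"
    using card[OF k(1)] by simp
  finally have "card K * card (N k) \<le> 2 * card H * card (N k)" .
  moreover have "subgroup (N k) G"
    using normal_imp_subgroup[OF N] k by simp
  hence "card (N k) > 0"
    using fin subgroup.finite_imp_card_positive by blast
  ultimately show ?thesis by simp
qed

text \<open>An element of \<open>H <#> P\<close> acts on \<open>Z\<close> by conjugation as its factor in \<open>H\<close> does.\<close>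

lemma (in group) normal_Int_central:
  assumes H: "subgroup H G" and Z: "Z \<lhd> G" and HP: "carrier G \<subseteq> H <#> P"
    and P: "P \<subseteq> carrier G"
    and central: "\<And>x z. x \<in> P \<Longrightarrow> z \<in> Z \<Longrightarrow> x \<otimes> z = z \<otimes> x"
  shows "H \<inter> Z \<lhd> G"
proof (rule normal_invI)
  interpret H: subgroup H G by fact
  interpret Z: normal Z G by fact
  show "subgroup (H \<inter> Z) G"
    using H Z normal_imp_subgroup subgroups_Inter_pair by blast
  fix g z assume g: "g \<in> carrier G" and z: "z \<in> H \<inter> Z"
  from g HP obtain h x where hx: "h \<in> H" "x \<in> P" "g = h \<otimes> x"
    unfolding set_mult_def by blast
  have c: "x \<in> carrier G" "h \<in> carrier G" "z \<in> carrier G"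
    using hx P z by auto
  have "x \<otimes> z \<otimes> inv x = z"
    using central[OF hx(2)] z c by (simp add: m_assoc)
  moreover have "g \<otimes> z \<otimes> inv g = h \<otimes> (x \<otimes> z \<otimes> inv x) \<otimes> inv h"
    unfolding hx(3) using c by (simp add: inv_mult_group m_assoc)
  ultimately show "g \<otimes> z \<otimes> inv g \<in> H \<inter> Z"
    using z hx(1) Z.inv_op_closed2[of h z] c by simp
qed

text \<open>\<open>N 0\<close> is the group P of the overview, and the series \<open>N\<close>
  stands for the 2-group above it. \<open>cW\<close> and \<open>cP\<close> say that |W:Z| and |P:W|
  are less than |Z|, which excludes a last step of index at least |Z| below which Z already
  lies.\<close>

theorem (in group) no_increasing_unrefinable_chain:
  assumes fin: "finite (carrier G)"
    and Z: "Z \<lhd> G" and W: "W \<lhd> G" and ZW: "Z \<subseteq> W" and WP: "W \<subseteq> N 0"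
    and N: "\<And>k. k \<le> m \<Longrightarrow> N k \<lhd> G"
    and mono: "\<And>k. k < m \<Longrightarrow> N k \<subseteq> N (Suc k)"
    and card: "\<And>k. k < m \<Longrightarrow> card (N (Suc k)) \<le> 2 * card (N k)"
    and top: "N m = carrier G"
    and odd: "odd (card Z)" and Z1: "Z \<noteq> {\<one>}"
    and cW: "card W < card Z * card Z" and cP: "card (N 0) < card W * card Z"
    and central: "\<And>x z. x \<in> N 0 \<Longrightarrow> z \<in> Z \<Longrightarrow> x \<otimes> z = z \<otimes> x"
    and comm: "\<And>x y. x \<in> N 0 \<Longrightarrow> y \<in> N 0 \<Longrightarrow> x \<otimes> y \<otimes> inv (y \<otimes> x) \<in> Z"
    and nonabelian: "\<exists>x\<in>N 0. \<exists>y\<in>N 0. x \<otimes> y \<noteq> y \<otimes> x"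
    and minimal: "\<And>S. S \<lhd> G \<Longrightarrow> S \<subseteq> Z \<Longrightarrow> S = {\<one>} \<or> S = Z"
  shows "\<not> (\<exists>n C. unrefinable_chain G n C \<and> increasing_chain G n C)"
proof safe
  fix n C assume chain: "unrefinable_chain G n C" and inc: "increasing_chain G n C"
  define P where "P = N 0"
  have P: "P \<lhd> G"
    using N by (simp add: P_def)
  have ZP: "Z \<subseteq> P"
    using ZW WP by (simp add: P_def)
  have sZ: "subgroup Z G" and sP: "subgroup P G"
    using Z P normal_imp_subgroup by auto
  have PG: "P \<subseteq> carrier G" and ZG: "Z \<subseteq> carrier G"
    using sZ sP subgroup.subset by auto
  have C0: "C 0 = {\<one>}" and Cn: "C n = carrier G"
    using chain by (auto simp: unrefinable_chain_def)
  have sub: "subgroup (C j) G" if "j \<le> n" for j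
    using chain that by (auto simp: unrefinable_chain_def)
  have cov: "covers (C j) (C (Suc j))" if "j < n" for j
    using unrefinable_chain_covers[OF chain that] .
  \<comment> \<open>Shifted by one: \<open>idx j\<close> belongs to the step from \<open>C j\<close>
    to \<open>C (Suc j)\<close>.\<close>
  define idx where "idx j = chain_index G C (Suc j)" for j
  have idx: "card (C (Suc j)) = idx j * card (C j)" if "j < n" for j
    using chain_index_mult[OF chain that fin] by (simp add: idx_def)
  have idx_mono: "idx i \<le> idx j" if "i \<le> j" "j < n" for i j
    using increasing_chain_mono[OF inc that] by (simp add: idx_def)
  have Cpos: "card (C j) > 0" if "j \<le> n" for j
    using fin sub[OF that] subgroup.finite_imp_card_positive by blast
  have "\<not> Z \<subseteq> C 0"
    using Z1 subgroup.one_closed[OF sZ] by (auto simp: C0)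
  moreover have "Z \<subseteq> C n"
    using ZG Cn by simp
  ultimately obtain k where k: "k < n" "\<not> Z \<subseteq> C k" "Z \<subseteq> C (Suc k)"
    using ex_least_nat_less[of "\<lambda>k. Z \<subseteq> C k" n] by blast
  have "card (C k) * card Z \<le> idx k * card (C k) * card (C k \<inter> Z)"
    using covers_card_ge[OF cov fin sZ k(3)] k(1) idx by simp
  hence idx_ge: "card Z \<le> idx k * card (C k \<inter> Z)"
    using Cpos[of k] k(1) by (simp add: mult.assoc mult.left_commute)
  \<comment> \<open>Hence from step \<open>k\<close> on no step can be one of index at most 2 in the 2-group \<open>G / P\<close>.\<close>
  have idx_k: "idx k > 2"
  proof -
    have "subgroup (C k \<inter> Z) (G\<lparr>carrier := Z\<rparr>)"
      using sub[of k] k(1) sZ by (intro subgroup_incl subgroups_Inter_pair) auto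
    from group.lagrange[OF subgroup_imp_group[OF sZ] this]
    \<comment> \<open>\<open>r\<close> is the index of \<open>C k \<inter> Z\<close> in
      \<open>Z\<close>, a divisor of an odd number and different from 1, so at least 3.\<close>
    obtain r where r: "card Z = r * card (C k \<inter> Z)"
      by (simp add: order_def) (metis)
    have "finite Z"
      using ZG fin finite_subset by blast
    hence "card (C k \<inter> Z) < card Z"
      using k(2) by (intro psubset_card_mono) auto
    hence "r \<noteq> 0" "r \<noteq> 1" "card (C k \<inter> Z) > 0"
      using r sub[of k] k(1) \<open>finite Z\<close> subgroup.one_closed[OF sZ] subgroup.one_closed[of "C k" G]
      by (auto simp: card_gt_0_iff)
    moreover have "r \<noteq> 2"
      using odd r by auto
    moreover have "r \<le> idx k"
      using idx_ge r \<open>card (C k \<inter> Z) > 0\<close> by simp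
    ultimately show ?thesis by linarith
  qed
  have step: "C j <#> (C (Suc j) \<inter> P) = C (Suc j)" if j: "k \<le> j" "j < n" for j
  proof (rule covers_eq_set_mult_Int[OF cov[OF j(2)] P])
    show "\<not> C (Suc j) \<inter> P \<subseteq> C j"
    proof
      assume "C (Suc j) \<inter> P \<subseteq> C j"
      hence "card (C (Suc j)) \<le> 2 * card (C j)"
        unfolding P_def by (intro covers_card_le_double[OF cov[OF j(2)] fin N mono card top])
      hence "idx j \<le> 2"
        using idx[OF j(2)] Cpos[of j] j(2) by simp
      thus False
        using idx_mono[OF j] idx_k by simp
    qed
  qed
  \<comment> \<open>Downward induction from \<open>C n\<close>: by \<open>step\<close>, each step
    from \<open>k\<close> on adds only factors from \<open>P\<close>.\<close>
  have full: "carrier G \<subseteq> C j <#> P" if "k \<le> j" "j \<le> n" for j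
    using that(2,1)
  proof (induction j rule: inc_induct)
    case base
    show ?case
    proof
      fix x assume "x \<in> carrier G"
      thus "x \<in> C n <#> P"
        unfolding set_mult_def Cn using subgroup.one_closed[OF sP] r_one[of x, symmetric] by blast
    qed
  next
    case (step j)
    have *: "carrier G \<subseteq> C (Suc j) <#> P"
      using step by simp
    have "C (Suc j) \<subseteq> C j <#> P"
      using \<open>k \<le> j \<Longrightarrow> j < n \<Longrightarrow> C j <#> (C (Suc j) \<inter> P) = C (Suc j)\<close> step
      unfolding set_mult_def by blast
    hence "C (Suc j) <#> P \<subseteq> (C j <#> P) <#> P"
      unfolding set_mult_def by blast
    also have "\<dots> = C j <#> (P <#> P)"
      using sub[of j] step subgroup.subset PG by (intro set_mult_assoc) auto
    also have "P <#> P = P"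
      using sP subgroup_mult_id by blast
    finally show ?case using * by blast
  qed
  have kP: "carrier G \<subseteq> C k <#> P"
    using full[of k] k(1) by simp
  \<comment> \<open>\<open>C k\<close> normalises the intersection and \<open>P\<close> centralises
    it. It is not all of \<open>Z\<close>, so minimality makes it trivial.\<close>
  have "C k \<inter> Z \<lhd> G"
    by (rule normal_Int_central[OF _ Z kP PG central[folded P_def]]) (use sub[of k] k(1) in auto)
  hence CkZ: "C k \<inter> Z = {\<one>}"
    using minimal[of "C k \<inter> Z"] k(2) by blast
  have idx_Z: "card Z \<le> idx k"
    using idx_ge by (simp add: CkZ)
  \<comment> \<open>If step \<open>k\<close> were the last, \<open>C k\<close> would be a complement
    of \<open>Z\<close>, and commutators of elements of \<open>C k \<inter> P\<close> would lie in
    \<open>C k \<inter> Z\<close>, hence be trivial.\<close>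
  have "Suc k \<noteq> n"
  proof
    assume n: "Suc k = n"
    have "C k <#> (C (Suc k) \<inter> Z) = C (Suc k)"
      using k by (intro covers_eq_set_mult_Int cov Z) auto
    hence CkZG: "C k <#> Z = carrier G"
      using n Cn ZG by (simp add: Int_absorb1)
    interpret Ck: subgroup "C k" G
      using sub k(1) by simp
    have "x \<otimes> y = y \<otimes> x" if "x \<in> P" "y \<in> P" for x y
    proof -
      have x: "x \<in> C k <#> Z" and y: "y \<in> C k <#> Z"
        using that PG by (auto simp: CkZG)
      from x obtain a z where az: "a \<in> C k" "z \<in> Z" "x = a \<otimes> z"
        by (auto simp: set_mult_def)
      from y obtain b w where bw: "b \<in> C k" "w \<in> Z" "y = b \<otimes> w"
        by (auto simp: set_mult_def)
      have zw: "z \<in> carrier G" "w \<in> carrier G"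
        using az bw ZG by auto
      \<comment> \<open>Removing the factor in \<open>Z\<close> does not leave \<open>P\<close>, so
        \<open>comm\<close> applies to \<open>a\<close> and \<open>b\<close>.\<close>
      have ab: "a \<in> P" "b \<in> P"
      proof -
        have "a = x \<otimes> inv z" "b = y \<otimes> inv w"
          unfolding az(3) bw(3) using az(1) bw(1) zw by (simp_all add: m_assoc)
        moreover have "inv z \<in> P" "inv w \<in> P"
          using az bw ZP subgroup.m_inv_closed[OF sZ] by auto
        ultimately show "a \<in> P" "b \<in> P"
          using that subgroup.m_closed[OF sP] by auto
      qed
      have "a \<otimes> b \<otimes> inv (b \<otimes> a) \<in> C k \<inter> Z"
        using az(1) bw(1) ab comm[folded P_def] by simp
      hence "a \<otimes> b \<otimes> inv (b \<otimes> a) = \<one>"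
        using CkZ by blast
      hence eq: "a \<otimes> b = b \<otimes> a"
        using az bw by (metis Ck.mem_carrier inv_equality inv_inv m_closed inv_closed)
      have c: "z \<otimes> b = b \<otimes> z" "w \<otimes> a = a \<otimes> w" "z \<otimes> w = w \<otimes> z"
        using central[folded P_def, of b z] central[folded P_def, of a w] central[folded P_def, of z w]
          ab az(2) bw(2) ZP by auto
      have "x \<otimes> y = a \<otimes> (z \<otimes> b) \<otimes> w"
        unfolding az(3) bw(3) using az(1) bw(1) zw by (simp add: m_assoc)
      also have "\<dots> = (a \<otimes> b) \<otimes> (z \<otimes> w)"
        unfolding c(1) using az(1) bw(1) zw by (simp add: m_assoc)
      also have "\<dots> = b \<otimes> (a \<otimes> w) \<otimes> z"
        unfolding eq c(3) using az(1) bw(1) zw by (simp add: m_assoc)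
      also have "\<dots> = y \<otimes> x"
        unfolding c(2)[symmetric] az(3) bw(3) using az(1) bw(1) zw by (simp add: m_assoc)
      finally show ?thesis .
    qed
    thus False
      using nonabelian by (auto simp: P_def)
  qed
  hence n: "Suc k < n"
    using k(1) by simp
  define M where "M = C (n - 1)"
  have n1: "Suc (n - 1) = n" "n - 1 < n" "Suc k \<le> n - 1"
    using n by auto
  have covM: "covers M (carrier G)"
    using cov[OF n1(2)] unfolding M_def n1(1) Cn .
  have sM: "subgroup M G" "M \<noteq> carrier G"
    using covM by (auto simp: covers_def)
  have "C (Suc k) \<subseteq> C j" if "Suc k \<le> j" "j \<le> n" for j
    using that
  proof (induction j rule: dec_induct)
    case (step j)
    thus ?case using cov[of j] by (auto simp: covers_def)
  qed simp
  hence ZM: "Z \<subseteq> M"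
    unfolding M_def using k(3) n1(2,3) by (meson less_imp_le subset_trans)
  have "card M * card Z \<le> card M * idx (n - 1)"
    using idx_Z idx_mono[of k "n - 1"] n1 by simp
  also have "\<dots> = card (carrier G)"
    using idx[OF n1(2)] unfolding M_def n1(1) Cn by (simp only: mult.commute)
  finally have MZ: "card M * card Z \<le> card (carrier G)" .
  have Mpos: "card M > 0"
    using Cpos[of "n - 1"] by (simp add: M_def)
  \<comment> \<open>If \<open>M\<close> contained \<open>A\<close> but not \<open>B\<close>, its
    index in \<open>G\<close>, at least |Z|, would be at most |B:A| < |Z|. Applied to Z < W and W <
    P, this forces \<open>P\<close> into \<open>M\<close>.\<close>
  have bound: False if "A \<lhd> G" "B \<lhd> G" "A \<subseteq> B" "A \<subseteq> M" "\<not> B \<subseteq> M" "card B < card A * card Z" for A B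
  proof -
    have "B \<subseteq> carrier G"
      using that normal_imp_subgroup subgroup.subset by blast
    hence "card (carrier G) * card A \<le> card M * card B"
      using that by (intro covers_card_le covM fin) auto
    also have "\<dots> < card M * (card A * card Z)"
      using that Mpos by simp
    also have "\<dots> = card M * card Z * card A"
      by simp
    also have "\<dots> \<le> card (carrier G) * card A"
      using MZ by (rule mult_le_mono1)
    finally show False by simp
  qed
  have "W \<subseteq> M"
    using bound[OF Z W ZW ZM] cW by blast
  hence "P \<subseteq> M"
    using bound[OF W P] WP cP by (auto simp: P_def)
  hence "M <#> P \<subseteq> M"
    using subgroup.m_closed[OF sM(1)] by (auto simp: set_mult_def)
  moreover have "carrier G \<subseteq> M <#> P"
    using full[of "n - 1"] n1 by (simp add: M_def)
  ultimately have "carrier G \<subseteq> M"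
    by blast
  thus False
    using sM subgroup.subset by blast
qed

section \<open>The group\<close>

text \<open>Addition modulo 2. The coordinates are indexed by \<open>bool\<close>, so it both
  composes swaps and applies a swap to an index.\<close>

definition bxor :: "bool \<Rightarrow> bool \<Rightarrow> bool" where
  "bxor i s \<longleftrightarrow> i \<noteq> s"

lemma bxor_simps [simp]:
  "bxor i False = i" "bxor False s = s" "bxor s s = False" "bxor s (bxor s t) = t"
  "bxor (bxor i s) t = bxor i (bxor s t)"
  by (auto simp: bxor_def)

text \<open>
  A signed permutation of two coordinates: \<open>(s, e)\<close> stands for the monomial matrix that first
  swaps the coordinates if \<open>s\<close> holds and then multiplies coordinate \<open>i\<close> by the sign \<open>e i\<close>.
\<close>

type_synonym sperm = "bool \<times> (bool \<Rightarrow> int)"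

definition sp_one :: sperm where
  "sp_one = (False, \<lambda>_. 1)"

fun sp_mult :: "sperm \<Rightarrow> sperm \<Rightarrow> sperm" where
  "sp_mult (s, e) (t, f) = (bxor s t, \<lambda>i. e i * f (bxor i s))"

text \<open>Signs are their own inverses, so inversion only permutes them.\<close>

fun sp_inv :: "sperm \<Rightarrow> sperm" where
  "sp_inv (s, e) = (s, \<lambda>i. e (bxor i s))"

fun sp_act :: "sperm \<Rightarrow> (bool \<Rightarrow> int) \<Rightarrow> bool \<Rightarrow> int" where
  "sp_act (s, e) v i = e i * v (bxor i s)"

definition signs :: "(bool \<Rightarrow> int) set" where
  "signs = {e. \<forall>i. e i * e i = 1}"

text \<open>The trivial group, the centre, the diagonal matrices, and the whole dihedral group of order 8.\<close>

definition sp :: "nat \<Rightarrow> sperm set" where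
  "sp k = (if k = 0 then {sp_one} else if k = 1 then {False} \<times> {\<lambda>_. 1, \<lambda>_. - 1}
     else if k = 2 then {False} \<times> signs else UNIV \<times> signs)"

lemma signs_sq: "e \<in> signs \<Longrightarrow> e i * e i = 1" "e \<in> signs \<Longrightarrow> e i * (e i * x) = x"
  by (simp_all add: signs_def flip: mult.assoc)

lemma signs_sq': "\<forall>i. e i * e i = (1 :: int) \<Longrightarrow> e i * (e i * x) = x"
  by (simp flip: mult.assoc)

lemma sp_mono: "k \<le> l \<Longrightarrow> sp k \<subseteq> sp l"
  by (auto simp: sp_def sp_one_def signs_def)

lemma sp_subset: "sp k \<subseteq> sp 3"
  by (auto simp: sp_def sp_one_def signs_def)

lemma sp_one_mem: "sp_one \<in> sp k"
  by (auto simp: sp_def sp_one_def signs_def)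

lemma sp_signs: "g \<in> sp k \<Longrightarrow> snd g \<in> signs"
  by (auto simp: sp_def sp_one_def signs_def split: if_splits)

lemma sp_mult_closed: "g \<in> sp k \<Longrightarrow> h \<in> sp k \<Longrightarrow> sp_mult g h \<in> sp k"
  by (auto simp: sp_def sp_one_def signs_def signs_sq' ac_simps split: if_splits)

lemma sp_inv_closed: "g \<in> sp k \<Longrightarrow> sp_inv g \<in> sp k"
  by (auto simp: sp_def sp_one_def signs_def split: if_splits)

lemma sp_mult_one [simp]: "sp_mult sp_one g = g" "sp_mult g sp_one = g"
  by (cases g; auto simp: sp_one_def)+

text \<open>Normality of each layer: it is trivial, the centre, the kernel of the swap component, or
  the whole group.\<close>

lemma sp_conj: "g \<in> sp 3 \<Longrightarrow> h \<in> sp k \<Longrightarrow> sp_mult (sp_mult g h) (sp_inv g) \<in> sp k"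
  by (cases g; cases h)
    (auto simp: sp_def sp_one_def signs_def signs_sq' ac_simps split: if_splits)

lemma card_PiE_UNIV: "card ((UNIV :: 'a :: finite set) \<rightarrow>\<^sub>E A) = card A ^ card (UNIV :: 'a set)"
  using card_PiE[of "UNIV :: 'a set" "\<lambda>_. A"] by simp

lemma card_signs: "card signs = 4"
proof -
  have eq: "signs = UNIV \<rightarrow>\<^sub>E {1, - 1}"
    by (auto simp: signs_def zmult_eq_1_iff PiE_UNIV_domain Pi_iff)
  show ?thesis
    unfolding eq card_PiE_UNIV by (simp add: power2_eq_square)
qed

lemma card_sp: "k \<le> 3 \<Longrightarrow> card (sp k) = 2 ^ k"
proof -
  assume "k \<le> 3"
  hence "k = 0 \<or> k = 1 \<or> k = 2 \<or> k = 3" by auto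
  moreover have "(\<lambda>_ :: bool. 1 :: int) \<noteq> (\<lambda>_. - 1)"
    by (simp add: fun_eq_iff)
  ultimately show ?thesis
    by (auto simp: sp_def card_signs card_cartesian_product)
qed

lemma sp_act_zero [simp]: "sp_act g (\<lambda>_. 0) i = 0"
  by (cases g) simp

lemma sp_act_one [simp]: "sp_act sp_one v i = v i"
  by (simp add: sp_one_def)

text \<open>
  \<open>(g, h, a, b, c)\<close> stands for the product of the block unitriangular matrix over the field with
  \<open>p\<close> elements whose entries above the diagonal are \<open>a\<close>, \<open>c\<close> and the transpose of \<open>b\<close>, and of the
  block diagonal matrix \<open>diag(g, 1, h)\<close>.
\<close>

type_synonym elt = "sperm \<times> sperm \<times> (bool \<Rightarrow> int) \<times> (bool \<Rightarrow> int) \<times> (bool \<Rightarrow> bool \<Rightarrow> int)"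

section \<open>Arithmetic of the extension of P by two dihedral groups\<close>

fun el_mult :: "int \<Rightarrow> elt \<Rightarrow> elt \<Rightarrow> elt" where
  "el_mult p (g, h, a, b, c) (g', h', a', b', c') =
     (sp_mult g g', sp_mult h h',
      \<lambda>i. (a i + sp_act g a' i) mod p, \<lambda>j. (b j + sp_act h b' j) mod p,
      \<lambda>i j. (c i j + sp_act g (\<lambda>k. sp_act h (c' k) j) i + a i * sp_act h b' j) mod p)"

text \<open>The inverse of \<open>(a, b, c)\<close> in P has the parts \<open>- a\<close>,
  \<open>- b\<close> and the tensor product of \<open>a\<close> and \<open>b\<close> minus
  \<open>c\<close>; the inverse signed permutations then act on them.\<close>

fun el_inv :: "int \<Rightarrow> elt \<Rightarrow> elt" where
  "el_inv p (g, h, a, b, c) =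
     (sp_inv g, sp_inv h,
      \<lambda>i. (- sp_act (sp_inv g) a i) mod p, \<lambda>j. (- sp_act (sp_inv h) b j) mod p,
      \<lambda>i j. sp_act (sp_inv g) (\<lambda>k. sp_act (sp_inv h) (\<lambda>l. a k * b l - c k l) j) i mod p)"

definition el_one :: elt where
  "el_one = (sp_one, sp_one, \<lambda>_. 0, \<lambda>_. 0, \<lambda>_ _. 0)"

text \<open>Entries are canonical residues, so that equality in the group is equality of
  functions.\<close>

definition vecs :: "int \<Rightarrow> (bool \<Rightarrow> int) set" where
  "vecs p = {v. \<forall>i. v i mod p = v i}"

definition mats :: "int \<Rightarrow> (bool \<Rightarrow> bool \<Rightarrow> int) set" where
  "mats p = {c. \<forall>i j. c i j mod p = c i j}"

lemma card_vecs: "card (vecs (int p)) = p ^ 2" if "p > 0"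
proof -
  have "vecs (int p) = UNIV \<rightarrow>\<^sub>E {0..<int p}"
    using that by (auto simp: vecs_def PiE_UNIV_domain Pi_iff mod_pos_pos_trivial)
      (metis of_nat_0_less_iff pos_mod_sign, metis of_nat_0_less_iff pos_mod_bound)
  thus ?thesis by (simp only: card_PiE_UNIV) simp
qed

lemma card_mats: "card (mats (int p)) = p ^ 4" if "p > 0"
proof -
  have "mats (int p) = UNIV \<rightarrow>\<^sub>E vecs (int p)"
    by (auto simp: vecs_def mats_def PiE_UNIV_domain Pi_iff)
  thus ?thesis by (simp only: card_PiE_UNIV) (simp add: card_vecs that flip: power_mult)
qed

text \<open>Rewrite rules, used beside \<open>mod_simps\<close>, that remove inner reductions from
  the shapes left by unfolding the signed actions.\<close>

lemma mod_mult_add: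
  fixes p :: int
  shows "(u + e * (x mod p)) mod p = (u + e * x) mod p"
    "(u + e * (f * (x mod p))) mod p = (u + e * (f * x)) mod p"
    "(u + x mod p * e) mod p = (u + x * e) mod p"
    "(u + e * (x mod p) + v) mod p = (u + e * x + v) mod p"
    "(u + e * (f * (x mod p)) + v) mod p = (u + e * (f * x) + v) mod p"
    "(x mod p + u + v) mod p = (x + u + v) mod p"
    "(u + x mod p - v) mod p = (u + x - v) mod p"
proof -
  show 1: "(u + e * (x mod p)) mod p = (u + e * x) mod p" for u e x
    by (metis mod_add_right_eq mod_mult_right_eq)
  show 2: "(u + e * (f * (x mod p))) mod p = (u + e * (f * x)) mod p" for u e f x
    using 1[of u "e * f" x] by (simp add: mult.assoc)
  show "(u + x mod p * e) mod p = (u + x * e) mod p"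
    using 1[of u e x] by (simp add: mult.commute)
  show "(u + e * (x mod p) + v) mod p = (u + e * x + v) mod p"
    using 1[of "u + v" e x] by (simp add: ac_simps)
  show "(u + e * (f * (x mod p)) + v) mod p = (u + e * (f * x) + v) mod p"
    using 2[of "u + v" e f x] by (simp add: ac_simps)
  show "(x mod p + u + v) mod p = (x + u + v) mod p"
    by (simp add: add.assoc mod_add_left_eq)
  show "(u + x mod p - v) mod p = (u + x - v) mod p"
    using 1[of "u - v" 1 x] by (simp add: algebra_simps)
qed

lemma el_mult_assoc:
  "el_mult p (el_mult p x y) z = el_mult p x (el_mult p y z)"
proof -
  obtain s e t f a b c where x: "x = ((s, e), (t, f), a, b, c)" by (cases x) auto
  obtain s' e' t' f' a' b' c' where y: "y = ((s', e'), (t', f'), a', b', c')" by (cases y) auto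
  obtain s'' e'' t'' f'' a'' b'' c'' where z: "z = ((s'', e''), (t'', f''), a'', b'', c'')"
    by (cases z) auto
  show ?thesis
    unfolding x y z
    by (simp add: fun_eq_iff mod_simps mod_mult_add) (simp add: algebra_simps)
qed

definition el_group :: "int \<Rightarrow> elt monoid" where
  "el_group p = \<lparr>carrier = sp 3 \<times> sp 3 \<times> vecs p \<times> vecs p \<times> mats p,
     monoid.mult = el_mult p, one = el_one\<rparr>"

lemma el_group_simps:
  "monoid.mult (el_group p) = el_mult p" "one (el_group p) = el_one"
  by (simp_all add: el_group_def)

lemma el_mult_closed:
  "x \<in> carrier (el_group p) \<Longrightarrow> y \<in> carrier (el_group p) \<Longrightarrow> el_mult p x y \<in> carrier (el_group p)"
  by (auto simp: el_group_def sp_mult_closed vecs_def mats_def simp del: sp_mult.simps)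

lemma el_one_closed: "el_one \<in> carrier (el_group p)"
  by (simp add: el_group_def el_one_def sp_one_mem vecs_def mats_def)

lemma el_one_mult: "x \<in> carrier (el_group p) \<Longrightarrow> el_mult p el_one x = x"
  by (auto simp: el_group_def el_one_def vecs_def mats_def)

lemma el_inv_closed: "x \<in> carrier (el_group p) \<Longrightarrow> el_inv p x \<in> carrier (el_group p)"
  by (auto simp: el_group_def sp_inv_closed vecs_def mats_def simp del: sp_inv.simps)

lemma el_inv_mult:
  assumes "x \<in> carrier (el_group p)"
  shows "el_mult p (el_inv p x) x = el_one"
proof -
  obtain s e t f a b c where x: "x = ((s, e), (t, f), a, b, c)" by (cases x) auto
  have "e \<in> signs" "f \<in> signs"
    using assms sp_signs[of "(s, e)" 3] sp_signs[of "(t, f)" 3] by (auto simp: el_group_def x)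
  thus ?thesis
    unfolding x el_one_def
    by (simp add: fun_eq_iff mod_simps mod_mult_add sp_one_def signs_sq)
      (simp add: algebra_simps mod_simps mod_mult_add signs_sq)
qed

lemma el_group_group: "group (el_group p)"
proof (rule groupI)
  show "\<exists>y\<in>carrier (el_group p). y \<otimes>\<^bsub>el_group p\<^esub> x = \<one>\<^bsub>el_group p\<^esub>"
    if "x \<in> carrier (el_group p)" for x
    using el_inv_closed[OF that] el_inv_mult[OF that]
    by (intro bexI[of _ "el_inv p x"]) (simp_all add: el_group_simps)
qed (use el_mult_closed el_one_mult el_mult_assoc el_one_closed in \<open>simp_all add: el_group_simps\<close>)

lemma el_group_inv: "x \<in> carrier (el_group p) \<Longrightarrow> inv\<^bsub>el_group p\<^esub> x = el_inv p x"
  using el_inv_closed[of x p] el_inv_mult[of x p]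
  by (intro group.inv_equality[OF el_group_group]) (simp_all add: el_group_simps)

section \<open>The subgroups Z, W, P and the layers above P\<close>

text \<open>One family for all subgroups in use: with \<open>k = l = 0\<close>, the flags
  \<open>False False\<close>, \<open>True False\<close> and \<open>True True\<close> give Z, W and
  P.\<close>

definition el_sub :: "int \<Rightarrow> nat \<Rightarrow> nat \<Rightarrow> bool \<Rightarrow> bool \<Rightarrow> elt set" where
  "el_sub p k l A B = sp k \<times> sp l \<times> (if A then vecs p else {\<lambda>_. 0}) \<times>
     (if B then vecs p else {\<lambda>_. 0}) \<times> mats p"

lemma el_sub_mono:
  assumes "k \<le> k'" "l \<le> l'" "A \<Longrightarrow> A'" "B \<Longrightarrow> B'"
  shows "el_sub p k l A B \<subseteq> el_sub p k' l' A' B'"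
  using sp_mono[OF assms(1)] sp_mono[OF assms(2)] assms(3,4)
  unfolding el_sub_def by (auto simp: vecs_def)

lemma carrier_el_group: "carrier (el_group p) = el_sub p 3 3 True True"
  by (simp add: el_group_def el_sub_def)

lemma el_sub_subgroup: "subgroup (el_sub p k l A B) (el_group p)"
proof -
  interpret group "el_group p" by (rule el_group_group)
  have sub: "el_sub p k l A B \<subseteq> carrier (el_group p)"
    unfolding carrier_el_group el_sub_def using sp_subset by (auto simp: vecs_def)
  show ?thesis
  proof (rule subgroupI[OF sub])
    show "el_sub p k l A B \<noteq> {}"
    proof -
      have "el_one \<in> el_sub p k l A B"
        by (simp add: el_sub_def el_one_def sp_one_mem vecs_def mats_def)
      thus ?thesis by blast
    qed
  next
    fix x assume x: "x \<in> el_sub p k l A B"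
    hence "inv\<^bsub>el_group p\<^esub> x = el_inv p x"
      using sub el_group_inv by blast
    with x show "inv\<^bsub>el_group p\<^esub> x \<in> el_sub p k l A B"
      by (cases A; cases B)
        (auto simp: el_sub_def sp_inv_closed vecs_def mats_def fun_eq_iff simp del: sp_inv.simps split: prod.splits)
  next
    fix x y assume "x \<in> el_sub p k l A B" "y \<in> el_sub p k l A B"
    thus "x \<otimes>\<^bsub>el_group p\<^esub> y \<in> el_sub p k l A B"
      by (cases A; cases B)
        (auto simp: el_group_simps el_sub_def sp_mult_closed vecs_def mats_def simp del: sp_mult.simps)
  qed
qed

text \<open>Conjugating a nontrivial signed permutation \<open>g\<close> by a vector
  \<open>a\<close> yields the vector part \<open>a - g a\<close>. So either both vector parts are
  free or both signed permutations are trivial.\<close>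

lemma el_sub_normal:
  assumes "A \<and> B \<or> k = 0 \<and> l = 0"
  shows "el_sub p k l A B \<lhd> el_group p"
proof -
  interpret group "el_group p" by (rule el_group_group)
  show ?thesis
  proof (rule normal_invI[OF el_sub_subgroup])
    fix x y assume x': "x \<in> carrier (el_group p)" and y': "y \<in> el_sub p k l A B"
    obtain s e t f a b c where x: "x = ((s, e), (t, f), a, b, c)" by (cases x) auto
    obtain g h a' b' c' where y: "y = (g, h, a', b', c')" by (cases y)
    have x3: "(s, e) \<in> sp 3" "(t, f) \<in> sp 3" and y3: "g \<in> sp k" "h \<in> sp l"
      using x' y' by (auto simp: el_group_def el_sub_def x y)
    have ef: "e \<in> signs" "f \<in> signs"
      using sp_signs[OF x3(1)] sp_signs[OF x3(2)] by auto
    note conj = sp_conj[OF x3(1) y3(1)] sp_conj[OF x3(2) y3(2)]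
    have "el_mult p (el_mult p x y) (el_inv p x) \<in> el_sub p k l A B"
    proof (cases "A \<and> B")
      case True
      thus ?thesis
        using conj by (simp add: x y el_sub_def vecs_def mats_def del: sp_mult.simps sp_inv.simps)
    next
      case False
      with assms have kl: "k = 0" "l = 0" by auto
      hence gh: "g = sp_one" "h = sp_one"
        using y3 by (auto simp: sp_def)
      have a: "\<not> A \<Longrightarrow> a' = (\<lambda>_. 0)" and b: "\<not> B \<Longrightarrow> b' = (\<lambda>_. 0)"
        using y' by (auto simp: y el_sub_def)
      show ?thesis
        using conj a b
        by (cases A; cases B)
          (auto simp: x y el_sub_def kl gh vecs_def mats_def mod_simps mod_mult_add signs_sq[OF ef(1)] signs_sq[OF ef(2)])
    qed
    thus "x \<otimes>\<^bsub>el_group p\<^esub> y \<otimes>\<^bsub>el_group p\<^esub> inv\<^bsub>el_group p\<^esub> x \<in> el_sub p k l A B"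
      using el_group_inv[OF x'] by (simp add: el_group_simps)
  qed
qed

lemma card_el_sub:
  assumes "p > 0" "k \<le> 3" "l \<le> 3"
  shows "card (el_sub (int p) k l A B) =
    2 ^ (k + l) * p ^ ((if A then 2 else 0) + (if B then 2 else 0) + 4)"
  using assms by (simp add: el_sub_def card_cartesian_product card_sp card_vecs card_mats power_add)

section \<open>Commutators and solubility\<close>

lemma (in group) derived_subset:
  assumes "subgroup B G" "\<And>x y. x \<in> A \<Longrightarrow> y \<in> A \<Longrightarrow> x \<otimes> y \<otimes> inv x \<otimes> inv y \<in> B"
  shows "derived G A \<subseteq> B"
  unfolding derived_def using assms by (intro generate_subgroup_incl) auto

text \<open>Swap components cancel in a commutator, and diagonal matrices commute.\<close>

lemma sp_commutator:
  "g \<in> sp 3 \<Longrightarrow> h \<in> sp 3 \<Longrightarrow> sp_mult (sp_mult (sp_mult g h) (sp_inv g)) (sp_inv h) \<in> sp 2"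
  "g \<in> sp 2 \<Longrightarrow> h \<in> sp 2 \<Longrightarrow> sp_mult (sp_mult (sp_mult g h) (sp_inv g)) (sp_inv h) \<in> sp 0"
proof -
  have comm: "bxor s t = bxor t s" "bxor s (bxor t u) = bxor t (bxor s u)" for s t u
    by (auto simp: bxor_def)
  show "g \<in> sp 3 \<Longrightarrow> h \<in> sp 3 \<Longrightarrow> sp_mult (sp_mult (sp_mult g h) (sp_inv g)) (sp_inv h) \<in> sp 2"
    by (cases g; cases h) (auto simp: sp_def signs_def signs_sq' ac_simps comm)
  show "g \<in> sp 2 \<Longrightarrow> h \<in> sp 2 \<Longrightarrow> sp_mult (sp_mult (sp_mult g h) (sp_inv g)) (sp_inv h) \<in> sp 0"
    by (cases g; cases h) (auto simp: sp_def signs_def signs_sq' ac_simps sp_one_def)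
qed

definition el_comm :: "int \<Rightarrow> elt \<Rightarrow> elt \<Rightarrow> elt" where
  "el_comm p x y = el_mult p (el_mult p (el_mult p x y) (el_inv p x)) (el_inv p y)"

lemma el_group_commutator:
  assumes "x \<in> carrier (el_group p)" "y \<in> carrier (el_group p)"
  shows "x \<otimes>\<^bsub>el_group p\<^esub> y \<otimes>\<^bsub>el_group p\<^esub> inv\<^bsub>el_group p\<^esub> x \<otimes>\<^bsub>el_group p\<^esub> inv\<^bsub>el_group p\<^esub> y
    = el_comm p x y"
  using assms by (simp add: el_group_inv el_comm_def el_group_simps)

lemma el_comm_3:
  "x \<in> el_sub p 3 3 True True \<Longrightarrow> y \<in> el_sub p 3 3 True True \<Longrightarrow> el_comm p x y \<in> el_sub p 2 2 True True"
  by (auto simp: el_sub_def el_comm_def sp_commutator vecs_def mats_def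
      simp del: sp_mult.simps sp_inv.simps)

lemma el_comm_2:
  "x \<in> el_sub p 2 2 True True \<Longrightarrow> y \<in> el_sub p 2 2 True True \<Longrightarrow> el_comm p x y \<in> el_sub p 0 0 True True"
  by (auto simp: el_sub_def el_comm_def sp_commutator vecs_def mats_def
      simp del: sp_mult.simps sp_inv.simps)

lemma sp_0: "sp 0 = {sp_one}"
  by (simp add: sp_def)

lemma sp_inv_one [simp]: "sp_inv sp_one = sp_one"
  by (simp add: sp_one_def)

lemma el_comm_0:
  "x \<in> el_sub p 0 0 True True \<Longrightarrow> y \<in> el_sub p 0 0 True True \<Longrightarrow> el_comm p x y \<in> el_sub p 0 0 False False"
  by (auto simp: el_sub_def sp_0 el_comm_def vecs_def mats_def mod_simps mod_mult_add)

lemma el_central: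
  "x \<in> el_sub p 0 0 True True \<Longrightarrow> y \<in> el_sub p 0 0 False False \<Longrightarrow> el_mult p x y = el_mult p y x"
  by (auto simp: el_sub_def sp_0 vecs_def mats_def add.commute)

text \<open>The derived series is bounded by \<open>el_sub p 2 2 True True\<close>, P, Z and the
  trivial group, hence four derivations.\<close>

lemma el_group_solvable: "solvable (el_group p)"
proof -
  interpret group "el_group p" by (rule el_group_group)
  let ?D = "derived (el_group p)"
  have sub: "el_sub p k l A B \<subseteq> carrier (el_group p)" for k l A B
    by (rule subgroup.subset[OF el_sub_subgroup])
  have *: "?D H \<subseteq> el_sub p k' l' A' B'"
    if "H \<subseteq> el_sub p k l A B" "\<And>x y. x \<in> el_sub p k l A B \<Longrightarrow> y \<in> el_sub p k l A B \<Longrightarrow> el_comm p x y \<in> el_sub p k' l' A' B'"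
    for k l A B k' l' A' B' H
  proof -
    have "?D H \<subseteq> ?D (el_sub p k l A B)"
      by (rule mono_derived[OF that(1)])
    also have "\<dots> \<subseteq> el_sub p k' l' A' B'"
    proof (rule derived_subset[OF el_sub_subgroup])
      fix x y assume xy: "x \<in> el_sub p k l A B" "y \<in> el_sub p k l A B"
      hence "x \<in> carrier (el_group p)" "y \<in> carrier (el_group p)"
        using sub by blast+
      from el_group_commutator[OF this] that(2)[OF xy]
      show "x \<otimes>\<^bsub>el_group p\<^esub> y \<otimes>\<^bsub>el_group p\<^esub> inv\<^bsub>el_group p\<^esub> x \<otimes>\<^bsub>el_group p\<^esub> inv\<^bsub>el_group p\<^esub> y
          \<in> el_sub p k' l' A' B'"
        by simp
    qed
    finally show ?thesis .
  qed
  have "?D (carrier (el_group p)) \<subseteq> el_sub p 2 2 True True"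
    by (rule *[OF _ el_comm_3]) (simp_all add: carrier_el_group)
  hence "?D (?D (carrier (el_group p))) \<subseteq> el_sub p 0 0 True True"
    by (rule *[OF _ el_comm_2])
  hence 3: "?D (?D (?D (carrier (el_group p)))) \<subseteq> el_sub p 0 0 False False" (is "?H \<subseteq> _")
    by (rule *[OF _ el_comm_0])
  have "?D ?H \<subseteq> {\<one>\<^bsub>el_group p\<^esub>}"
  proof (rule derived_subset[OF triv_subgroup])
    fix x y assume "x \<in> ?H" "y \<in> ?H"
    hence xy: "x \<in> el_sub p 0 0 False False" "y \<in> el_sub p 0 0 False False"
      using 3 by auto
    \<comment> \<open>Z is abelian because it lies in P, which centralises it.\<close>
    hence "x \<in> el_sub p 0 0 True True"
      using el_sub_mono[of 0 0 0 0 False True False True p] by auto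
    hence "x \<otimes>\<^bsub>el_group p\<^esub> y = y \<otimes>\<^bsub>el_group p\<^esub> x"
      using el_central xy by (simp add: el_group_simps)
    moreover have "x \<in> carrier (el_group p)" "y \<in> carrier (el_group p)"
      using xy sub by blast+
    ultimately show "x \<otimes>\<^bsub>el_group p\<^esub> y \<otimes>\<^bsub>el_group p\<^esub> inv\<^bsub>el_group p\<^esub> x \<otimes>\<^bsub>el_group p\<^esub> inv\<^bsub>el_group p\<^esub> y
        \<in> {\<one>\<^bsub>el_group p\<^esub>}"
      by (simp add: m_assoc)
  qed
  moreover have "subgroup (?D ?H) (el_group p)"
    using derived_in_carrier derived_is_subgroup by simp
  ultimately have "?D ?H = {\<one>\<^bsub>el_group p\<^esub>}"
    using subgroup.one_closed by blast
  hence "(?D ^^ 4) (carrier (el_group p)) = {\<one>\<^bsub>el_group p\<^esub>}"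
    by (simp add: numeral_eq_Suc)
  thus ?thesis
    using solvable_iff_trivial_derived_seq by blast
qed

section \<open>Z is a minimal normal subgroup\<close>

definition zel :: "(bool \<Rightarrow> bool \<Rightarrow> int) \<Rightarrow> elt" where
  "zel c = (sp_one, sp_one, \<lambda>_. 0, \<lambda>_. 0, c)"

lemma el_sub_zel: "el_sub p 0 0 False False = zel ` mats p"
  by (auto simp: el_sub_def sp_0 zel_def)

definition unit_mat :: "int \<Rightarrow> bool \<Rightarrow> bool \<Rightarrow> int \<Rightarrow> bool \<Rightarrow> bool \<Rightarrow> int" where
  "unit_mat p k l m i j = (if i = k \<and> j = l then m mod p else 0)"

text \<open>A Bezout inverse of \<open>u\<close>, scaled by \<open>m\<close>. The solution is
  natural because multiples arise by repeated addition.\<close>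

lemma coprime_solve:
  fixes u p :: int
  assumes "coprime u p" "p > 0"
  obtains n :: nat where "(int n * u) mod p = m mod p"
proof -
  obtain x y where xy: "x * u + y * p = 1"
    using bezout_int[of u p] assms by auto
  define n where "n = nat ((m * x) mod p)"
  have "int n * u mod p = (m * x) * u mod p"
    using assms by (simp add: n_def mod_mult_left_eq)
  also have "(m * x) * u = m * (x * u + y * p) + (- m * y) * p"
    by (simp add: algebra_simps)
  also have "\<dots> mod p = m mod p"
    unfolding xy by (simp only: mod_mult_self1 mult_1_right)
  finally show ?thesis using that by blast
qed

text \<open>Sign changes isolate one nonzero entry of a matrix, its multiples run through the whole
  field, swaps carry it to every position, and sums give all matrices.\<close>

lemma el_sub_minimal:
  assumes p: "prime p" "odd p" and S: "S \<lhd> el_group (int p)" and SZ: "S \<subseteq> el_sub (int p) 0 0 False False"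
  shows "S = {\<one>\<^bsub>el_group (int p)\<^esub>} \<or> S = el_sub (int p) 0 0 False False"
proof -
  let ?G = "el_group (int p)"
  let ?p = "int p"
  interpret group ?G by (rule el_group_group)
  interpret S: normal S ?G by (rule S)
  have p0: "?p > 0"
    using p prime_gt_0_nat by simp
  define T where "T = {c. zel c \<in> S}"
  have S_T: "S = zel ` T"
    using SZ by (auto simp: T_def el_sub_zel)
  have T_mats: "T \<subseteq> mats ?p"
    using SZ by (auto simp: T_def el_sub_zel zel_def)
  have add: "(\<lambda>i j. (c i j + d i j) mod ?p) \<in> T" if "c \<in> T" "d \<in> T" for c d
    using S.m_closed[of "zel c" "zel d"] that by (simp add: T_def el_group_simps zel_def)
  have zero: "(\<lambda>_ _. 0) \<in> T"
    using S.one_closed by (simp add: T_def el_group_simps zel_def el_one_def)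
  have act: "(\<lambda>i j. e i * (f j * c (bxor i s) (bxor j t)) mod ?p) \<in> T" (is "?c \<in> T")
    if c: "c \<in> T" and ef: "e \<in> signs" "f \<in> signs" for c e f s t
  proof -
    \<comment> \<open>Conjugation by this element is the required signed permutation of rows and
      columns.\<close>
    define x :: elt where "x = ((s, e), (t, f), \<lambda>_. 0, \<lambda>_. 0, \<lambda>_ _. 0)"
    have x: "x \<in> carrier ?G"
      using ef by (simp add: x_def el_group_def sp_def vecs_def mats_def)
    have c': "c \<in> mats ?p"
      using c T_mats by blast
    hence zc: "zel c \<in> carrier ?G" "zel ?c \<in> carrier ?G"
      by (auto simp: el_group_def zel_def sp_one_mem vecs_def mats_def)
    have "x \<otimes>\<^bsub>?G\<^esub> zel c = zel ?c \<otimes>\<^bsub>?G\<^esub> x"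
      by (simp add: el_group_simps x_def zel_def sp_one_def)
    hence "x \<otimes>\<^bsub>?G\<^esub> zel c \<otimes>\<^bsub>?G\<^esub> inv\<^bsub>?G\<^esub> x = zel ?c"
      using x zc by (simp add: m_assoc)
    thus ?thesis
      using S.inv_op_closed2[OF x, of "zel c"] c by (simp add: T_def)
  qed
  show ?thesis
  proof (cases "T \<subseteq> {\<lambda>_ _. 0}")
    case True
    hence "T = {\<lambda>_ _. 0}" using zero by blast
    thus ?thesis
      by (simp add: S_T zel_def el_group_simps el_one_def)
  next
    case False
    then obtain c where c: "c \<in> T" "c \<noteq> (\<lambda>_ _. 0)" by blast
    then obtain k l where kl: "c k l \<noteq> 0" by (auto simp: fun_eq_iff)
    have cm: "c i j mod ?p = c i j" for i j
      using c T_mats by (auto simp: mats_def)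
    \<comment> \<open>Adding to a matrix its image under the signs \<open>d k\<close> doubles row
      \<open>k\<close> and cancels the other row.\<close>
    define d where "d m i = (if i = m then 1 else - 1 :: int)" for m i :: bool
    have d: "d m \<in> signs" "(\<lambda>_. 1) \<in> signs" for m
      by (auto simp: d_def signs_def)
    define r where "r = (\<lambda>i j. if i = k then (2 * c i j) mod ?p else 0)"
    have "(\<lambda>i j. (c i j + d k i * (1 * c (bxor i False) (bxor j False)) mod ?p) mod ?p) = r"
      by (auto simp: r_def fun_eq_iff d_def mod_simps)
    hence r: "r \<in> T"
      using add[OF c(1) act[OF c(1) d(1)[of k] d(2), of False False]] by simp
    \<comment> \<open>The same for columns leaves a single entry \<open>4 * c k l\<close>, and 4 is
      invertible because \<open>p\<close> is odd.\<close>
    have "(\<lambda>i j. (r i j + 1 * (d l j * r (bxor i False) (bxor j False)) mod ?p) mod ?p)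
        = unit_mat ?p k l (4 * c k l)"
      by (auto simp: unit_mat_def r_def fun_eq_iff d_def mod_simps)
    hence u: "unit_mat ?p k l (4 * c k l) \<in> T"
      using add[OF r act[OF r d(2) d(1)[of l], of False False]] by simp
    have mult: "unit_mat ?p k l (int n * (4 * c k l)) \<in> T" for n
    proof (induction n)
      case 0
      have "unit_mat ?p k l (int 0 * (4 * c k l)) = (\<lambda>_ _. 0)"
        by (simp add: unit_mat_def fun_eq_iff)
      thus ?case using zero by simp
    next
      case (Suc n)
      have "(\<lambda>i j. (unit_mat ?p k l (int n * (4 * c k l)) i j + unit_mat ?p k l (4 * c k l) i j) mod ?p)
          = unit_mat ?p k l (int (Suc n) * (4 * c k l))"
        by (auto simp: unit_mat_def fun_eq_iff mod_simps algebra_simps)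
      thus ?case using add[OF Suc u] by simp
    qed
    have "\<not> ?p dvd c k l"
      using kl cm[of k l] by (auto simp: dvd_eq_mod_eq_0)
    hence "coprime (c k l) ?p"
      using p prime_imp_coprime[of ?p "c k l"] by (simp add: coprime_commute)
    moreover have "coprime 4 ?p"
    proof -
      have "coprime 2 ?p"
        using p by (simp add: coprime_left_2_iff_odd)
      hence "coprime (2 * 2) ?p"
        by (simp only: coprime_mult_left_iff simp_thms)
      thus ?thesis by simp
    qed
    ultimately have cop: "coprime (4 * c k l) ?p"
      by simp
    have kl_T: "unit_mat ?p k l m \<in> T" for m
    proof -
      obtain n where n: "(int n * (4 * c k l)) mod ?p = m mod ?p"
        using coprime_solve[OF cop p0] by blast
      have "unit_mat ?p k l m = unit_mat ?p k l (int n * (4 * c k l))"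
        unfolding unit_mat_def n ..
      thus ?thesis using mult by simp
    qed
    have unit_T: "unit_mat ?p i' j' m \<in> T" for i' j' m
    proof -
      \<comment> \<open>Adding \<open>bxor k i'\<close> exchanges \<open>k\<close> with
        \<open>i'\<close>, and likewise for the columns.\<close>
      have "(\<lambda>i j. 1 * (1 * unit_mat ?p k l m (bxor i (bxor k i')) (bxor j (bxor l j'))) mod ?p)
          = unit_mat ?p i' j' m"
        by (auto simp: unit_mat_def fun_eq_iff bxor_def)
      thus ?thesis
        using act[OF kl_T d(2) d(2), of m "bxor k i'" "bxor l j'"] by simp
    qed
    have "mats ?p \<subseteq> T"
    proof
      fix m assume "m \<in> mats ?p"
      hence m: "m i j mod ?p = m i j" for i j
        by (simp add: mats_def)
      define row where "row i' i j = (unit_mat ?p i' True (m i' True) i j + unit_mat ?p i' False (m i' False) i j) mod ?p"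
        for i' i j
      have "row i' \<in> T" for i'
        unfolding row_def by (intro add unit_T)
      hence "(\<lambda>i j. (row True i j + row False i j) mod ?p) \<in> T"
        by (intro add)
      also have "(\<lambda>i j. (row True i j + row False i j) mod ?p) = m"
      proof (intro ext)
        fix i j show "(row True i j + row False i j) mod ?p = m i j"
          by (cases i; cases j; simp add: row_def unit_mat_def m)
      qed
      finally show "m \<in> T" .
    qed
    thus ?thesis
      using T_mats by (simp add: S_T el_sub_zel subset_antisym)
  qed
qed

lemma el_group_no_chain:
  assumes p: "prime p" "odd p"
  shows "\<not> (\<exists>n C. unrefinable_chain (el_group (int p)) n C \<and> increasing_chain (el_group (int p)) n C)"
proof -
  let ?p = "int p"
  let ?G = "el_group ?p"
  interpret group ?G by (rule el_group_group)
  have p0: "p > 0" and p1: "p > 1"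
    using p prime_gt_0_nat prime_gt_1_nat by auto
  \<comment> \<open>The first dihedral factor is built up in three layers of index 2, then the
    second; truncated subtraction keeps the latter trivial up to \<open>k = 3\<close>.\<close>
  define N where "N k = el_sub ?p (min k 3) (k - 3) True True" for k
  have sub: "el_sub ?p k l A B \<subseteq> carrier ?G" for k l A B
    by (rule subgroup.subset[OF el_sub_subgroup])
  have card_G: "card (carrier ?G) = 2 ^ 6 * p ^ 8"
    using p0 by (simp add: carrier_el_group card_el_sub)
  have N0: "N 0 = el_sub ?p 0 0 True True"
    by (simp add: N_def)
  show ?thesis
  proof (rule no_increasing_unrefinable_chain[where N = N and m = 6
        and W = "el_sub ?p 0 0 True False" and Z = "el_sub ?p 0 0 False False"])
    show "finite (carrier ?G)"
      using card_G p0 by (intro card_ge_0_finite) simp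
    show "el_sub ?p 0 0 False False \<lhd> ?G" "el_sub ?p 0 0 True False \<lhd> ?G"
      by (rule el_sub_normal, simp)+
    show "N k \<lhd> ?G" for k
      unfolding N_def by (rule el_sub_normal) simp
    show "el_sub ?p 0 0 False False \<subseteq> el_sub ?p 0 0 True False"
      "el_sub ?p 0 0 True False \<subseteq> N 0"
      unfolding N0 by (rule el_sub_mono; simp)+
    show "N k \<subseteq> N (Suc k)" for k
      unfolding N_def by (rule el_sub_mono) auto
    show "card (N (Suc k)) \<le> 2 * card (N k)" if "k < 6" for k
    proof -
      have "min (Suc k) 3 + (Suc k - 3) = Suc k" "min k 3 + (k - 3) = k"
        by auto
      thus ?thesis
        using p0 that unfolding N_def by (subst (1 2) card_el_sub) auto
    qed
    show "N 6 = carrier ?G"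
      by (simp add: N_def carrier_el_group)
    have cZ: "card (el_sub ?p 0 0 False False) = p ^ 4"
      using p0 by (simp add: card_el_sub)
    show "odd (card (el_sub ?p 0 0 False False))"
      using p by (simp add: cZ)
    show "el_sub ?p 0 0 False False \<noteq> {\<one>\<^bsub>?G\<^esub>}"
      using cZ p1 by (metis One_nat_def card.empty card_insert_disjoint empty_iff finite.emptyI
          nat_power_eq_Suc_0_iff less_irrefl zero_neq_numeral)
    \<comment> \<open>Z, W and P have orders \<open>p ^ 4\<close>, \<open>p ^ 6\<close> and
      \<open>p ^ 8\<close>.\<close>
    show "card (el_sub ?p 0 0 True False) < card (el_sub ?p 0 0 False False) * card (el_sub ?p 0 0 False False)"
      "card (N 0) < card (el_sub ?p 0 0 True False) * card (el_sub ?p 0 0 False False)"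
      using p0 p1 by (simp_all add: N0 card_el_sub flip: power_add)
    show "x \<otimes>\<^bsub>?G\<^esub> z = z \<otimes>\<^bsub>?G\<^esub> x" if "x \<in> N 0" "z \<in> el_sub ?p 0 0 False False" for x z
      using that el_central by (simp add: N0 el_group_simps)
    show "x \<otimes>\<^bsub>?G\<^esub> y \<otimes>\<^bsub>?G\<^esub> inv\<^bsub>?G\<^esub> (y \<otimes>\<^bsub>?G\<^esub> x) \<in> el_sub ?p 0 0 False False"
      if "x \<in> N 0" "y \<in> N 0" for x y
    proof -
      have xy: "x \<in> carrier ?G" "y \<in> carrier ?G"
        using that sub unfolding N0 by blast+
      hence "x \<otimes>\<^bsub>?G\<^esub> y \<otimes>\<^bsub>?G\<^esub> inv\<^bsub>?G\<^esub> (y \<otimes>\<^bsub>?G\<^esub> x) = el_comm ?p x y"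
        by (simp add: inv_mult_group flip: el_group_commutator m_assoc)
      thus ?thesis
        using that el_comm_0 by (simp add: N0)
    qed
    show "\<exists>x\<in>N 0. \<exists>y\<in>N 0. x \<otimes>\<^bsub>?G\<^esub> y \<noteq> y \<otimes>\<^bsub>?G\<^esub> x"
    proof -
      \<comment> \<open>The last components of the two products have all entries 1 and all entries
        0, respectively.\<close>
      define x :: elt where "x = (sp_one, sp_one, \<lambda>_. 1, \<lambda>_. 0, \<lambda>_ _. 0)"
      define y :: elt where "y = (sp_one, sp_one, \<lambda>_. 0, \<lambda>_. 1, \<lambda>_ _. 0)"
      have "x \<in> N 0" "y \<in> N 0"
        using p1 by (simp_all add: x_def y_def N0 el_sub_def sp_0 vecs_def mats_def)
      moreover have "x \<otimes>\<^bsub>?G\<^esub> y \<noteq> y \<otimes>\<^bsub>?G\<^esub> x"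
        using p1 by (simp add: x_def y_def el_group_simps fun_eq_iff)
      ultimately show ?thesis by blast
    qed
    show "S = {\<one>\<^bsub>?G\<^esub>} \<or> S = el_sub ?p 0 0 False False"
      if "S \<lhd> ?G" "S \<subseteq> el_sub ?p 0 0 False False" for S
      by (rule el_sub_minimal[OF p that])
  qed
qed

section \<open>Transfer to the natural numbers\<close>

text \<open>\<open>f\<close> is an isomorphism onto the image group, so chains pull back. Preimages
  are cut down to the carrier, as injectivity is assumed only there.\<close>

lemma image_group_unrefinable_chain:
  assumes G: "group G" and inj: "inj_on f (carrier G)"
    and chain: "unrefinable_chain (image_group f G) n C"
  defines "D \<equiv> \<lambda>i. carrier G \<inter> f -` C i"
  shows "unrefinable_chain G n D" and "\<And>i. i \<le> n \<Longrightarrow> C i = f ` D i"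
proof -
  let ?H = "image_group f G"
  interpret G: group G by (rule G)
  interpret H: group ?H
    by (rule G.inj_imp_image_group_is_group[OF inj])
  have iso: "f \<in> iso G ?H"
    by (rule inj_imp_image_group_iso[OF inj])
  interpret f: group_hom G ?H f
    using iso by unfold_locales (auto simp: iso_def)
  have carr: "carrier ?H = f ` carrier G"
    by (simp add: image_group_carrier)
  have sub: "subgroup (C i) ?H" if "i \<le> n" for i
    using chain that by (simp add: unrefinable_chain_def)
  show CD: "C i = f ` D i" if "i \<le> n" for i
    using subgroup.subset[OF sub[OF that]] by (auto simp: D_def carr)
  have subD: "subgroup (D i) G" if "i \<le> n" for i
  proof (rule G.subgroupI)
    interpret C: subgroup "C i" ?H by (rule sub[OF that])
    show "D i \<subseteq> carrier G"
      by (simp add: D_def)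
    have "\<one>\<^bsub>G\<^esub> \<in> D i"
      using C.one_closed by (simp add: D_def del: f.hom_one flip: f.hom_one)
    thus "D i \<noteq> {}" by blast
    show "inv\<^bsub>G\<^esub> x \<in> D i" if "x \<in> D i" for x
      using that C.m_inv_closed by (simp add: D_def)
    show "x \<otimes>\<^bsub>G\<^esub> y \<in> D i" if "x \<in> D i" "y \<in> D i" for x y
      using that C.m_closed by (simp add: D_def)
  qed
  have img_eq: "A = B" if "f ` A = f ` B" "A \<subseteq> carrier G" "B \<subseteq> carrier G" for A B
    using that inj inj_on_image_eq_iff by metis
  have D_carr: "D i \<subseteq> carrier G" for i
    by (simp add: D_def)
  have max: "maximal_subgroup (D (i - 1)) (G\<lparr>carrier := D i\<rparr>)" if i: "i \<in> {1..n}" for i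
  proof -
    have le: "i \<le> n" "i - 1 \<le> n"
      using i by auto
    have maxC: "maximal_subgroup (C (i - 1)) (?H\<lparr>carrier := C i\<rparr>)"
      using chain i by (simp add: unrefinable_chain_def)
    hence sC: "subgroup (C (i - 1)) (?H\<lparr>carrier := C i\<rparr>)" and neC: "C (i - 1) \<noteq> C i"
      by (simp_all add: maximal_subgroup_def)
    have "D (i - 1) \<subseteq> D i"
      using subgroup.subset[OF sC] by (auto simp: D_def)
    hence "subgroup (D (i - 1)) (G\<lparr>carrier := D i\<rparr>)"
      by (intro G.subgroup_incl subD le)
    moreover have "D (i - 1) \<noteq> D i"
      using neC CD[OF le(1)] CD[OF le(2)] by auto
    moreover have "K = D (i - 1) \<or> K = D i"
      if K: "subgroup K (G\<lparr>carrier := D i\<rparr>)" "D (i - 1) \<subseteq> K" for K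
    proof -
      have KG: "subgroup K G"
        by (rule G.incl_subgroup[OF subD[OF le(1)] K(1)])
      have "K \<subseteq> D i"
        using subgroup.subset[OF K(1)] by simp
      hence "f ` K \<subseteq> C i"
        unfolding CD[OF le(1)] by (rule image_mono)
      hence "subgroup (f ` K) (?H\<lparr>carrier := C i\<rparr>)"
        by (intro H.subgroup_incl f.subgroup_img_is_subgroup[OF KG] sub le)
      moreover have "C (i - 1) \<subseteq> f ` K"
        unfolding CD[OF le(2)] using K(2) by (rule image_mono)
      ultimately have "f ` K = C (i - 1) \<or> f ` K = C i"
        using maxC by (simp add: maximal_subgroup_def)
      thus ?thesis
        using img_eq[OF _ subgroup.subset[OF KG] D_carr] CD[OF le(1)] CD[OF le(2)] by metis
    qed
    ultimately show ?thesis
      by (simp add: maximal_subgroup_def)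
  qed
  have "f ` D 0 = f ` {\<one>\<^bsub>G\<^esub>}"
    using chain CD[of 0] by (simp add: unrefinable_chain_def)
  hence "D 0 = {\<one>\<^bsub>G\<^esub>}"
    by (rule img_eq) (simp_all add: D_carr)
  moreover have "f ` D n = f ` carrier G"
    using chain CD[of n] by (simp add: unrefinable_chain_def carr)
  hence "D n = carrier G"
    by (rule img_eq) (simp_all add: D_carr)
  ultimately show "unrefinable_chain G n D"
    using subD max by (simp add: unrefinable_chain_def)
qed

text \<open>Each index is determined by the orders of two consecutive members, and \<open>f\<close>
  preserves these.\<close>

lemma image_group_increasing_chain:
  assumes G: "group G" and inj: "inj_on f (carrier G)" and fin: "finite (carrier G)"
    and chain: "unrefinable_chain (image_group f G) n C"
    and inc: "increasing_chain (image_group f G) n C"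
  defines "D \<equiv> \<lambda>i. carrier G \<inter> f -` C i"
  shows "increasing_chain G n D"
proof -
  let ?H = "image_group f G"
  interpret G: group G by (rule G)
  interpret H: group ?H
    by (rule G.inj_imp_image_group_is_group[OF inj])
  have chainD: "unrefinable_chain G n D" and CD: "\<And>i. i \<le> n \<Longrightarrow> C i = f ` D i"
    using image_group_unrefinable_chain[OF G inj chain] by (simp_all add: D_def)
  have card: "card (C i) = card (D i)" if "i \<le> n" for i
    unfolding CD[OF that] by (intro card_image inj_on_subset[OF inj]) (simp add: D_def)
  have index: "chain_index G D (Suc j) = chain_index ?H C (Suc j)" if j: "j < n" for j
  proof -
    have "chain_index G D (Suc j) * card (D j) = card (D (Suc j))"
      by (rule G.chain_index_mult[OF chainD j fin])
    moreover have "chain_index ?H C (Suc j) * card (D j) = card (D (Suc j))"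
      using H.chain_index_mult[OF chain j] fin card[of j] card[of "Suc j"] j
      by (simp add: image_group_carrier)
    moreover have "subgroup (D j) G"
      using chainD j by (simp add: unrefinable_chain_def)
    hence "card (D j) > 0"
      using fin subgroup.finite_imp_card_positive by blast
    ultimately show ?thesis
      by (metis mult_cancel2 not_gr_zero)
  qed
  show ?thesis
    unfolding increasing_chain_def
  proof
    fix i assume i: "i \<in> {1..<n}"
    then obtain j where j: "i = Suc j"
      by (cases i) auto
    show "chain_index G D i \<le> chain_index G D (i + 1)"
      using inc i index[of j] index[of "Suc j"] by (simp add: increasing_chain_def j)
  qed
qed

theorem theorem1:
  fixes p :: nat
  assumes "prime p" and "odd p"
  shows "\<exists>G :: nat monoid. group G \<and> solvable G \<and> order G = 2 ^ 6 * p ^ 8 \<and>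
           \<not> (\<exists>n C. unrefinable_chain G n C \<and> increasing_chain G n C)"
proof -
  let ?G = "el_group (int p)"
  interpret G: group ?G by (rule el_group_group)
  have p0: "p > 0"
    using assms(1) by (rule prime_gt_0_nat)
  have card: "card (carrier ?G) = 2 ^ 6 * p ^ 8"
    using p0 by (simp add: carrier_el_group card_el_sub)
  hence fin: "finite (carrier ?G)"
    using p0 by (intro card_ge_0_finite) simp
  then obtain f :: "elt \<Rightarrow> nat" where f: "inj_on f (carrier ?G)"
    using finite_imp_inj_to_nat_seg by metis
  let ?H = "image_group f ?G"
  interpret H: group ?H
    by (rule G.inj_imp_image_group_is_group[OF f])
  interpret f: group_hom ?G ?H f
    using inj_imp_image_group_iso[OF f] by unfold_locales (auto simp: iso_def)
  have "solvable ?H"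
    using f.solvable_imp_solvable_img[of "carrier ?G"] el_group_solvable
    by (simp add: solvable_def image_group_carrier)
  moreover have "order ?H = 2 ^ 6 * p ^ 8"
    by (simp only: order_def image_group_carrier card_image[OF f] card)
  moreover have "\<not> (\<exists>n C. unrefinable_chain ?H n C \<and> increasing_chain ?H n C)"
    using image_group_unrefinable_chain(1)[OF el_group_group f]
      image_group_increasing_chain[OF el_group_group f fin] el_group_no_chain[OF assms] by blast
  ultimately show ?thesis
    using H.group_axioms by blast
qed

end
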